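(* Every (classical and not necessarily terminating) $\mathrm{EC}(\mathcal{D})$ $T=(r,V,E)$ with $r=\emptyset$ (the empty word) has a branch $B$ such that for every vertex $u\in B$ and every two distinct points $p,q$ that are letters of $u$ one has $|pq|\ne1$. Thus no general classical $\mathrm{EC}(\mathcal{D})$ constructs $$\mathcal{K}=\{ab\in\mathcal{P}^2\;|\;|ab|=1\}$$ (the unit length) from nothing, i.e. from the empty word.
   Context: For a set (alphabet) $A$, $A^*$ is the set of finite words over $A$, including the empty word $\emptyset$. A rooted tree $T=(r,V,E)$ consists of a vertex set $V$, a root $r\in V$ and edges $E\subset V\times V$ such that for every $u\in V$ there is a unique walk from $r$ to $u$; if $(u,v)\in E$ then $v$ is a child of $u$; a leaf is a vertex with no child; a branch is a maximal (finite or infinite) walk; it starts at $r$ and either ends in a leaf or is infinite. $\mathcal{P}=\mathbb{R}^2$ is the set of points, $\mathcal{L}$ the set of lines in $\mathbb{R}^2$, $\mathcal{C}$ the set of circles of positive radius in $\mathbb{R}^2$; elements of $\mathcal{L}\cup\mathcal{C}$ are called curves. $|ab|$ is the Euclidean distance of points $a,b$. For points $a\ne b$, $l(a,b)$ is the line through $a,b$. For points $a$ and $b\neq c$, $k(a,b,c)$ is the circle with center $a$ and radius $|bc|$; moreover $k(a,b,b)=a\in\mathcal{P}$. $\mathcal{D}$ is the set of all open discs in $\mathbb{R}^2$ with positive radii. A pair of points $ab\in\mathcal{P}^2$ is regarded as a two-letter word. Let $\mathcal{S}$ be a set of nonempty subsets of $\mathbb{R}^2$ with $(\mathcal{P}\cup\mathcal{L}\cup\mathcal{C})\cap\mathcal{S}=\emptyset$.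 An $\mathrm{EC}(\mathcal{S})$ (Euclidean construction with $\mathcal{S}$-arbitrary points) is a rooted tree $T=(r,V,E)$ with $V\subset(\mathcal{P}\cup\mathcal{L}\cup\mathcal{C}\cup\mathcal{S})^*$ and $r\in(\mathcal{P}\cup\mathcal{L}\cup\mathcal{C})^*$, in which the children of each vertex $u=a_1a_2\dots a_m$, $m\ge0$, are determined by exactly one of the following rules; in rules 1–5, $u$ is deterministic, i.e. $m=0$ or $a_m\notin\mathcal{S}$. 1. $u$ is a leaf. 2. $u$ has exactly one child $a_1\dots a_ma_{m+1}$, where $a_{m+1}=l(a_i,a_j)$ for some $1\le i<j\le m$ with $a_i,a_j\in\mathcal{P}$, $a_i\ne a_j$. 3. $u$ has exactly one child $a_1\dots a_ma_{m+1}$, where $a_{m+1}=k(a_i,a_j,a_k)$ for some $1\le i,j,k\le m$ with $a_i,a_j,a_k\in\mathcal{P}$. 4. $u$ has exactly one child $a_1\dots a_ma_{m+1}$, where $a_{m+1}\in\mathcal{P}$ is an intersection point of two curves $a_i\ne a_j$, $1\le i<j\le m$. 5. $u$ has exactly one child $a_1\dots a_ma_{m+1}$, where $a_{m+1}\in\mathcal{S}$. 6. $m\ge1$, $a_m\in\mathcal{S}$ ($u$ is non-deterministic) and the children of $u$ are exactly the words $a_1\dots a_ma_{m+1}$, one for each point $a_{m+1}\in a_m$. A general construction is one in which all these rules are allowed (both compass and straightedge). $T$ is classical if $\mathcal{S}=\mathcal{D}$. $T$ is terminating if all its branches are finite. For $\mathcal{K}\subset(\mathcal{P}\cup\mathcal{L}\cup\mathcal{C})^*$,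 an $\mathrm{EC}(\mathcal{S})$ of a certain type constructs $\mathcal{K}$ from $r$ if there is a terminating $\mathrm{EC}(\mathcal{S})$ $T=(r,V,E)$ of that type with root $r$ such that every leaf $a_1\dots a_m$ of $T$ has a final segment $a_ja_{j+1}\dots a_m\in\mathcal{K}$. *)

theory Defs
  imports "HOL-Analysis.Analysis"
begin

section \<open>Rooted trees and their branches\<close>

text \<open>A walk is a nonempty finite or an infinite sequence of consecutive vertices.\<close>

datatype 'v walk = FinWalk "'v list" | InfWalk "nat \<Rightarrow> 'v"

fun walk_verts :: "'v walk \<Rightarrow> 'v set" where
  "walk_verts (FinWalk vs) = set vs"
| "walk_verts (InfWalk f) = range f"

fun is_walk :: "'v set \<Rightarrow> ('v \<times> 'v) set \<Rightarrow> 'v walk \<Rightarrow> bool" where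
  "is_walk V E (FinWalk vs) \<longleftrightarrow>
     vs \<noteq> [] \<and> set vs \<subseteq> V \<and> (\<forall>i. Suc i < length vs \<longrightarrow> (vs ! i, vs ! Suc i) \<in> E)"
| "is_walk V E (InfWalk f) \<longleftrightarrow> range f \<subseteq> V \<and> (\<forall>i. (f i, f (Suc i)) \<in> E)"

definition children :: "('v \<times> 'v) set \<Rightarrow> 'v \<Rightarrow> 'v set" where
  "children E u = {v. (u, v) \<in> E}"

definition is_leaf :: "'v set \<Rightarrow> ('v \<times> 'v) set \<Rightarrow> 'v \<Rightarrow> bool" where
  "is_leaf V E u \<longleftrightarrow> u \<in> V \<and> children E u = {}"

definition rooted_tree :: "'v \<Rightarrow> 'v set \<Rightarrow> ('v \<times> 'v) set \<Rightarrow> bool" where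
  "rooted_tree r V E \<longleftrightarrow> r \<in> V \<and> E \<subseteq> V \<times> V \<and>
     (\<forall>u\<in>V. \<exists>!vs. is_walk V E (FinWalk vs) \<and> hd vs = r \<and> last vs = u)"

text \<open>A branch is a maximal walk: it cannot be prolonged at either end. That this means starting
  at the root and being infinite or ending in a leaf is lemma \<open>branch_iff\<close> below.\<close>

fun branch :: "'v set \<Rightarrow> ('v \<times> 'v) set \<Rightarrow> 'v walk \<Rightarrow> bool" where
  "branch V E (FinWalk vs) \<longleftrightarrow> is_walk V E (FinWalk vs) \<and>
     (\<nexists>v. is_walk V E (FinWalk (v # vs))) \<and> (\<nexists>v. is_walk V E (FinWalk (vs @ [v])))"
| "branch V E (InfWalk f) \<longleftrightarrow> is_walk V E (InfWalk f) \<and>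
     (\<nexists>v. is_walk V E (InfWalk (case_nat v f)))"

definition terminating :: "'v set \<Rightarrow> ('v \<times> 'v) set \<Rightarrow> bool" where
  "terminating V E \<longleftrightarrow> (\<forall>B. branch V E B \<longrightarrow> (\<exists>vs. B = FinWalk vs))"

lemma is_walk_Cons:
  assumes "E \<subseteq> V \<times> V" "is_walk V E (FinWalk vs)"
  shows "is_walk V E (FinWalk (v # vs)) \<longleftrightarrow> (v, hd vs) \<in> E"
  using assms by (auto simp: nth_Cons hd_conv_nth split: nat.splits)

lemma is_walk_snoc:
  assumes "E \<subseteq> V \<times> V" "is_walk V E (FinWalk vs)"
  shows "is_walk V E (FinWalk (vs @ [v])) \<longleftrightarrow> (last vs, v) \<in> E"
proof
  assume walk: "is_walk V E (FinWalk (vs @ [v]))"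
  obtain ws w where vs: "vs = ws @ [w]"
    using assms(2) by (cases vs rule: rev_cases) auto
  have "((vs @ [v]) ! length ws, (vs @ [v]) ! Suc (length ws)) \<in> E"
    using walk unfolding is_walk.simps vs by (metis length_append_singleton lessI)
  then show "(last vs, v) \<in> E"
    by (simp add: vs nth_append)
next
  assume "(last vs, v) \<in> E"
  then show "is_walk V E (FinWalk (vs @ [v]))"
    using assms by (cases vs rule: rev_cases) (auto simp: nth_append less_Suc_eq)
qed

lemma is_walk_case_nat:
  assumes "E \<subseteq> V \<times> V" "is_walk V E (InfWalk f)"
  shows "is_walk V E (InfWalk (case_nat v f)) \<longleftrightarrow> (v, f 0) \<in> E"
proof
  assume "is_walk V E (InfWalk (case_nat v f))"
  then have "(case_nat v f 0, case_nat v f (Suc 0)) \<in> E"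
    unfolding is_walk.simps by blast
  then show "(v, f 0) \<in> E" by simp
next
  assume "(v, f 0) \<in> E"
  then show "is_walk V E (InfWalk (case_nat v f))"
    using assms by (fastforce simp: image_subset_iff split: nat.splits)
qed

lemma rooted_tree_no_pred_iff:
  assumes "rooted_tree r V E" "u \<in> V"
  shows "(\<nexists>v. (v, u) \<in> E) \<longleftrightarrow> u = r"
proof
  assume no: "\<nexists>v. (v, u) \<in> E"
  obtain vs where vs: "is_walk V E (FinWalk vs)" "hd vs = r" "last vs = u"
    using assms unfolding rooted_tree_def by blast
  have "length vs = 1"
  proof (rule ccontr)
    assume "length vs \<noteq> 1"
    then have len: "length vs \<ge> 2"
      using vs(1) by (cases vs) (auto simp: Suc_le_eq)
    then have "(vs ! (length vs - 2), vs ! Suc (length vs - 2)) \<in> E"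
      using vs(1) by simp
    moreover have "vs ! Suc (length vs - 2) = u"
      using len vs(1,3) by (cases vs rule: rev_cases) (auto simp: nth_append Suc_diff_le)
    ultimately show False using no by metis
  qed
  then show "u = r"
    using vs by (auto simp: length_Suc_conv)
next
  assume u: "u = r"
  have tree: "r \<in> V" "E \<subseteq> V \<times> V"
    and uniq: "\<And>w vs ws. w \<in> V \<Longrightarrow> is_walk V E (FinWalk vs) \<Longrightarrow> hd vs = r \<Longrightarrow> last vs = w \<Longrightarrow>
      is_walk V E (FinWalk ws) \<Longrightarrow> hd ws = r \<Longrightarrow> last ws = w \<Longrightarrow> vs = ws"
    using assms(1) unfolding rooted_tree_def by blast+
  show "\<nexists>v. (v, u) \<in> E"
  proof
    assume "\<exists>v. (v, u) \<in> E"
    then obtain v where v: "(v, r) \<in> E" using u by blast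
    obtain vs where vs: "is_walk V E (FinWalk vs)" "hd vs = r" "last vs = v"
      using assms(1) v tree unfolding rooted_tree_def by blast
    have "is_walk V E (FinWalk (vs @ [r]))"
      using is_walk_snoc[OF tree(2) vs(1)] vs v by simp
    moreover have "is_walk V E (FinWalk [r])" using tree by simp
    ultimately have "vs @ [r] = [r]"
      using vs by (intro uniq[of r]) (auto simp: tree hd_append)
    then show False using vs(1) by simp
  qed
qed

lemma branch_iff:
  assumes "rooted_tree r V E"
  shows "branch V E (FinWalk vs) \<longleftrightarrow> is_walk V E (FinWalk vs) \<and> hd vs = r \<and> is_leaf V E (last vs)"
    and "branch V E (InfWalk f) \<longleftrightarrow> is_walk V E (InfWalk f) \<and> f 0 = r"
proof -
  have E: "E \<subseteq> V \<times> V" using assms by (simp add: rooted_tree_def)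
  show "branch V E (FinWalk vs) \<longleftrightarrow> is_walk V E (FinWalk vs) \<and> hd vs = r \<and> is_leaf V E (last vs)"
  proof (cases "is_walk V E (FinWalk vs)")
    case True
    then have "hd vs \<in> V" "last vs \<in> V" by auto
    then show ?thesis
      using True rooted_tree_no_pred_iff[OF assms, of "hd vs"]
      unfolding branch.simps is_walk_Cons[OF E True] is_walk_snoc[OF E True]
      by (auto simp: is_leaf_def children_def)
  qed (simp only: branch.simps simp_thms)
  show "branch V E (InfWalk f) \<longleftrightarrow> is_walk V E (InfWalk f) \<and> f 0 = r"
  proof (cases "is_walk V E (InfWalk f)")
    case True
    then have "f 0 \<in> V" by auto
    then show ?thesis
      using True rooted_tree_no_pred_iff[OF assms, of "f 0"]
      unfolding branch.simps is_walk_case_nat[OF E True] by blast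
  qed (simp only: branch.simps simp_thms)
qed


section \<open>Points, curves and discs in the plane\<close>

type_synonym point = "real^2"

definition lines :: "point set set" where
  "lines = {affine hull {a, b} | a b. a \<noteq> b}"

definition circles :: "point set set" where
  "circles = {sphere a \<rho> | a \<rho>. \<rho> > 0}"

definition curves :: "point set set" where
  "curves = lines \<union> circles"

definition discs :: "point set set" where
  "discs = {ball a \<rho> | a \<rho>. \<rho> > 0}"

text \<open>Letters of words: a point, or a subset of the plane (a line, a circle or a member of the
  given family \<open>S\<close>).\<close>

datatype letter = Pt point | Fig "point set"

definition line_through :: "point \<Rightarrow> point \<Rightarrow> letter" where
  "line_through a b = Fig (affine hull {a, b})"

definition circle_with :: "point \<Rightarrow> point \<Rightarrow> point \<Rightarrow> letter" where
  "circle_with a b c = (if b = c then Pt a else Fig (sphere a (dist b c)))"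


section \<open>Euclidean constructions with arbitrary points\<close>

text \<open>The family \<open>S\<close> cannot contain points, since points and sets are letters of different
  kinds.\<close>

definition admissible :: "point set set \<Rightarrow> bool" where
  "admissible S \<longleftrightarrow> {} \<notin> S \<and> curves \<inter> S = {}"

definition deterministic :: "point set set \<Rightarrow> letter list \<Rightarrow> bool" where
  "deterministic S u \<longleftrightarrow> u = [] \<or> last u \<notin> Fig ` S"

text \<open>\<open>EC_rule S u W\<close>: one of the rules allows \<open>W\<close> as the set of children of the vertex \<open>u\<close>.
  The rules \<open>circle\<close> (in the degenerate case) and \<open>intersection\<close> may produce the same point.\<close>

inductive EC_rule :: "point set set \<Rightarrow> letter list \<Rightarrow> letter list set \<Rightarrow> bool"
  for S :: "point set set" and u :: "letter list"
where
  leaf: "deterministic S u \<Longrightarrow> EC_rule S u {}"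
| line: "\<lbrakk>deterministic S u; i < j; j < length u; u ! i = Pt a; u ! j = Pt b; a \<noteq> b\<rbrakk>
    \<Longrightarrow> EC_rule S u {u @ [line_through a b]}"
| circle: "\<lbrakk>deterministic S u; i < length u; j < length u; k < length u;
     u ! i = Pt a; u ! j = Pt b; u ! k = Pt c\<rbrakk>
    \<Longrightarrow> EC_rule S u {u @ [circle_with a b c]}"
| intersection: "\<lbrakk>deterministic S u; i < j; j < length u; u ! i = Fig X; u ! j = Fig Y;
     X \<in> curves; Y \<in> curves; X \<noteq> Y; p \<in> X \<inter> Y\<rbrakk>
    \<Longrightarrow> EC_rule S u {u @ [Pt p]}"
| introduce: "\<lbrakk>deterministic S u; X \<in> S\<rbrakk> \<Longrightarrow> EC_rule S u {u @ [Fig X]}"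
| arbitrary_point: "\<lbrakk>u \<noteq> []; last u = Fig X; X \<in> S\<rbrakk> \<Longrightarrow> EC_rule S u {u @ [Pt p] | p. p \<in> X}"

text \<open>General constructions, that is, with both compass and straightedge. They are classical
  for \<open>S = discs\<close>.\<close>

definition EC :: "point set set \<Rightarrow> letter list \<Rightarrow> letter list set
    \<Rightarrow> (letter list \<times> letter list) set \<Rightarrow> bool" where
  "EC S r V E \<longleftrightarrow> admissible S \<and> rooted_tree r V E \<and>
     V \<subseteq> lists (range Pt \<union> Fig ` (curves \<union> S)) \<and>
     r \<in> lists (range Pt \<union> Fig ` curves) \<and>
     (\<forall>u\<in>V. EC_rule S u (children E u))"

definition constructs_from :: "point set set \<Rightarrow> letter list set \<Rightarrow> letter list \<Rightarrow> bool" where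
  "constructs_from S K r \<longleftrightarrow> (\<exists>V E. EC S r V E \<and> terminating V E \<and>
     (\<forall>u. is_leaf V E u \<longrightarrow> (\<exists>j<length u. drop j u \<in> K)))"

definition unit_pairs :: "letter list set" where
  "unit_pairs = {[Pt a, Pt b] | a b. dist a b = 1}"

lemma admissible_discs: "admissible discs"
proof -
  have "interior (sphere a \<rho>) = {}" for a :: point and \<rho>
    by (meson interior_subset negligible_sphere negligible_subset open_interior open_not_negligible)
  moreover have "interior (affine hull {a, b}) = {}" for a b :: point
    by (rule empty_interior_affine_hull) (auto simp: card_insert_if)
  ultimately have "interior X = {}" if "X \<in> curves" for X
    using that by (auto simp: curves_def lines_def circles_def)
  moreover have "interior X \<noteq> {}" if "X \<in> discs" for X
    using that by (auto simp: discs_def)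
  ultimately show ?thesis
    unfolding admissible_def by fastforce
qed

end

theory Submission
  imports Defs
begin

text \<open>Fix a number \<open>s > 0\<close> outside the smallest subfield of the reals closed under square roots,
  and measure all coordinates in units of \<open>1 / s\<close>. Along a suitable branch these coordinates
  stay in a countable subfield \<open>F\<close> that is closed under square roots and does not contain \<open>s\<close>.
  Two points at distance 1 would have distance \<open>s\<close> in the new units, and so \<open>s\<close> would lie in \<open>F\<close>.
  The deterministic steps do not leave \<open>F\<close>. For an arbitrary point, it suffices to find in every
  interval a number \<open>u\<close> such that \<open>s\<close> is not the value at \<open>u\<close> of a term built from \<open>F\<close> by
  subtraction, division and square roots. There are countably many such terms, so otherwise the
  Baire category theorem gives one that is constantly \<open>s\<close> on some interval; evaluation at a
  rational number then puts \<open>s\<close> into \<open>F\<close>.\<close>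

section \<open>Fields closed under square roots\<close>

text \<open>As \<open>sqrt (- x) = - sqrt x\<close> and \<open>x / 0 = 0\<close>, no side conditions are needed.\<close>

definition euclidean_field :: "real set \<Rightarrow> bool" where
  "euclidean_field F \<longleftrightarrow> 1 \<in> F \<and> (\<forall>x\<in>F. \<forall>y\<in>F. x - y \<in> F \<and> x / y \<in> F) \<and> (\<forall>x\<in>F. sqrt x \<in> F)"

context
  fixes F assumes F: "euclidean_field F"
begin

lemma euclidean_field_diff: "x \<in> F \<Longrightarrow> y \<in> F \<Longrightarrow> x - y \<in> F"
  and euclidean_field_divide: "x \<in> F \<Longrightarrow> y \<in> F \<Longrightarrow> x / y \<in> F"
  and euclidean_field_sqrt: "x \<in> F \<Longrightarrow> sqrt x \<in> F"
  and euclidean_field_1: "1 \<in> F"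
  using F by (auto simp: euclidean_field_def)

lemma euclidean_field_0: "0 \<in> F"
  using euclidean_field_diff[OF euclidean_field_1 euclidean_field_1] by simp

lemma euclidean_field_uminus: "x \<in> F \<Longrightarrow> - x \<in> F"
  using euclidean_field_diff[OF euclidean_field_0] by simp

lemma euclidean_field_add: "x \<in> F \<Longrightarrow> y \<in> F \<Longrightarrow> x + y \<in> F"
  using euclidean_field_diff[OF _ euclidean_field_uminus, of x y] by simp

text \<open>A product is the quotient \<open>x / (1 / y)\<close>, which is 0 as well when
  \<open>y = 0\<close>.\<close>

lemma euclidean_field_mult: "x \<in> F \<Longrightarrow> y \<in> F \<Longrightarrow> x * y \<in> F"
  using euclidean_field_divide[OF _ euclidean_field_divide[OF euclidean_field_1], of x y] by simp

lemma euclidean_field_power: "x \<in> F \<Longrightarrow> x ^ n \<in> F"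
  by (induction n) (auto intro: euclidean_field_1 euclidean_field_mult)

lemma euclidean_field_of_nat: "of_nat n \<in> F"
  by (induction n) (auto intro: euclidean_field_0 euclidean_field_1 euclidean_field_add)

lemma euclidean_field_numeral: "numeral n \<in> F"
  using euclidean_field_of_nat[of "numeral n"] by simp

lemma euclidean_field_Rats: "x \<in> \<rat> \<Longrightarrow> x \<in> F"
proof (induction rule: Rats_cases')
  case (1 a b)
  have "of_int n \<in> F" for n
    by (cases n) (simp_all add: euclidean_field_of_nat euclidean_field_uminus del: of_nat_Suc)
  then show ?case using 1 by (simp add: euclidean_field_divide)
qed

lemmas euclidean_field_closed = euclidean_field_diff euclidean_field_divide euclidean_field_sqrt
  euclidean_field_1 euclidean_field_0 euclidean_field_uminus euclidean_field_add
  euclidean_field_mult euclidean_field_power euclidean_field_numeral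

text \<open>Completing the square shows that \<open>2 * a * t + b\<close> is, up to sign, the square
  root of the discriminant. For \<open>a = 0\<close> the equation is linear and a division solves
  it.\<close>

lemma euclidean_field_quadratic_root:
  assumes "a \<in> F" "b \<in> F" "c \<in> F" "a * t\<^sup>2 + b * t + c = 0" "a \<noteq> 0 \<or> b \<noteq> 0"
  shows "t \<in> F"
proof (cases "a = 0")
  case True
  then have "t = - c / b" using assms by (simp add: field_simps)
  moreover have "- c / b \<in> F" using assms by (intro euclidean_field_closed)
  ultimately show ?thesis by simp
next
  case False
  have "b\<^sup>2 - 4 * a * c - (2 * a * t + b)\<^sup>2 = - 4 * a * (a * t\<^sup>2 + b * t + c)"
    by (simp add: algebra_simps power2_eq_square)
  then have "(2 * a * t + b)\<^sup>2 = b\<^sup>2 - 4 * a * c" using assms(4) by simp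
  then have root: "\<bar>2 * a * t + b\<bar> = sqrt (b\<^sup>2 - 4 * a * c)" by (metis real_sqrt_abs)
  moreover have "sqrt (b\<^sup>2 - 4 * a * c) \<in> F" using assms by (intro euclidean_field_closed)
  ultimately have "2 * a * t + b \<in> F"
    by (metis abs_real_def euclidean_field_uminus minus_minus)
  then have "(2 * a * t + b - b) / (2 * a) \<in> F"
    using assms(1,2) by (intro euclidean_field_divide euclidean_field_diff euclidean_field_mult
        euclidean_field_numeral)
  moreover have "(2 * a * t + b - b) / (2 * a) = t" using False by simp
  ultimately show ?thesis by simp
qed

text \<open>Along the line the second equation becomes a quadratic in one parameter. Its leading
  coefficient is \<open>a'\<close> and its linear one is the determinant
  \<open>c' * b - b' * c\<close>, so \<open>ne\<close> keeps it from degenerating.\<close>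

lemma euclidean_field_line_meets:
  fixes x y :: real
  assumes F': "b \<in> F" "c \<in> F" "d \<in> F" "a' \<in> F" "b' \<in> F" "c' \<in> F" "d' \<in> F"
    and nz: "b \<noteq> 0 \<or> c \<noteq> 0" and ne: "a' \<noteq> 0 \<or> c' * b \<noteq> b' * c"
    and line: "b * x + c * y + d = 0"
    and curve: "a' * (x\<^sup>2 + y\<^sup>2) + b' * x + c' * y + d' = 0"
  shows "x \<in> F \<and> y \<in> F"
proof -
  \<comment> \<open>up to a factor, the coordinate along the line\<close>
  define t where "t = b * y - c * x"
  define n where "n = b\<^sup>2 + c\<^sup>2"
  have n: "n \<noteq> 0" using nz by (simp add: n_def sum_power2_eq_zero_iff)
  \<comment> \<open>Cramer's rule for the line equation together with
    \<open>b * y - c * x = t\<close>; the determinant is \<open>n\<close>.\<close>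
  have x: "n * x = - d * b - c * t" and y: "n * y = b * t - d * c"
    using line unfolding n_def t_def power2_eq_square by algebra+
  \<comment> \<open>This is \<open>n\<close> times the curve equation, since
    \<open>n * (x\<^sup>2 + y\<^sup>2) = t\<^sup>2 + d\<^sup>2\<close>.\<close>
  have "a' * t\<^sup>2 + (c' * b - b' * c) * t + (a' * d\<^sup>2 - d * (b * b' + c * c') + d' * n) = 0"
    using line curve unfolding n_def t_def by algebra
  moreover have "n \<in> F" unfolding n_def using F' by (intro euclidean_field_closed)
  moreover have "c' * b - b' * c \<in> F" "a' * d\<^sup>2 - d * (b * b' + c * c') + d' * n \<in> F"
    using F' \<open>n \<in> F\<close> by (simp_all only: euclidean_field_closed)
  moreover have "a' \<noteq> 0 \<or> c' * b - b' * c \<noteq> 0" using ne by simp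
  ultimately have "t \<in> F"
    using euclidean_field_quadratic_root[OF F'(4)] by blast
  then have "(- d * b - c * t) / n \<in> F" "(b * t - d * c) / n \<in> F"
    using F' \<open>n \<in> F\<close> by (simp_all only: euclidean_field_closed)
  moreover have "x = (- d * b - c * t) / n" "y = (b * t - d * c) / n"
    using n x y by (metis nonzero_mult_div_cancel_left)+
  ultimately show ?thesis by metis
qed

end

section \<open>Terms\<close>

text \<open>Constants are indices into an enumeration of the base field instead of reals, which
  makes the type of terms countable.\<close>

datatype tm = Var | Const nat | Minus tm tm | Div tm tm | Sqrt tm

instance tm :: countable by countable_datatype

primrec tm_val :: "(nat \<Rightarrow> real) \<Rightarrow> tm \<Rightarrow> real \<Rightarrow> real" where
  "tm_val c Var u = u"
| "tm_val c (Const n) u = c n"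
| "tm_val c (Minus t t') u = tm_val c t u - tm_val c t' u"
| "tm_val c (Div t t') u = tm_val c t u / tm_val c t' u"
| "tm_val c (Sqrt t) u = sqrt (tm_val c t u)"

lemma tm_val_in_euclidean_field:
  assumes "euclidean_field F" "range c \<subseteq> F" "u \<in> F"
  shows "tm_val c t u \<in> F"
  using assms(2,3)
  by (induction t) (auto simp: euclidean_field_diff[OF assms(1)] euclidean_field_divide[OF assms(1)]
      euclidean_field_sqrt[OF assms(1)])

text \<open>Each required operation is a constructor of terms. If \<open>c\<close> enumerates a
  field closed under square roots, this is its smallest extension of the same kind that contains
  \<open>u\<close>.\<close>

lemma euclidean_field_range_tm_val:
  assumes "1 \<in> range c"
  shows "euclidean_field (range (\<lambda>t. tm_val c t u))"
proof -
  obtain n where "1 = c n" using assms by blast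
  then have "1 = tm_val c (Const n) u" by simp
  moreover have "tm_val c t u - tm_val c t' u = tm_val c (Minus t t') u"
    "tm_val c t u / tm_val c t' u = tm_val c (Div t t') u"
    "sqrt (tm_val c t u) = tm_val c (Sqrt t) u" for t t' by simp_all
  ultimately show ?thesis
    unfolding euclidean_field_def by blast
qed

section \<open>Functions continuous on the pieces of a countable closed cover\<close>

text \<open>Terms with a division need not be continuous. This weaker property survives division,
  and the closed pieces make Baire's theorem applicable.\<close>

definition sigma_continuous :: "(real \<Rightarrow> real) \<Rightarrow> bool" where
  "sigma_continuous f \<longleftrightarrow> (\<exists>\<K>. countable \<K> \<and> (\<forall>K\<in>\<K>. closed K \<and> continuous_on K f) \<and> \<Union>\<K> = UNIV)"

lemma sigma_continuous_if_continuous: "continuous_on UNIV f \<Longrightarrow> sigma_continuous f"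
  unfolding sigma_continuous_def by (rule exI[of _ "{UNIV}"]) auto

lemma sigma_continuous_compose:
  assumes "sigma_continuous f" "continuous_on UNIV g"
  shows "sigma_continuous (\<lambda>u. g (f u))"
proof -
  have "continuous_on K (\<lambda>u. g (f u))" if "continuous_on K f" for K
    using continuous_on_compose2[OF assms(2) that] by simp
  then show ?thesis using assms(1) unfolding sigma_continuous_def by blast
qed

text \<open>The pairwise intersections of the two covers serve both functions.\<close>

lemma sigma_continuous_common_cover:
  assumes "sigma_continuous f" "sigma_continuous g"
  obtains \<K> where "countable \<K>" "\<Union>\<K> = UNIV"
    "\<And>K. K \<in> \<K> \<Longrightarrow> closed K \<and> continuous_on K f \<and> continuous_on K g"
proof -
  obtain \<K> \<K>' where
    \<K>: "countable \<K>" "\<And>K. K \<in> \<K> \<Longrightarrow> closed K \<and> continuous_on K f" "\<Union>\<K> = UNIV" and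
    \<K>': "countable \<K>'" "\<And>K. K \<in> \<K>' \<Longrightarrow> closed K \<and> continuous_on K g" "\<Union>\<K>' = UNIV"
    using assms unfolding sigma_continuous_def by meson
  show ?thesis
  proof
    show "countable ((\<lambda>(K, K'). K \<inter> K') ` (\<K> \<times> \<K>'))" using \<K> \<K>' by auto
    show "\<Union> ((\<lambda>(K, K'). K \<inter> K') ` (\<K> \<times> \<K>')) = UNIV" using \<K>(3) \<K>'(3) by fastforce
  next
    fix L assume "L \<in> (\<lambda>(K, K'). K \<inter> K') ` (\<K> \<times> \<K>')"
    then obtain K K' where L: "L = K \<inter> K'" "K \<in> \<K>" "K' \<in> \<K>'" by auto
    then show "closed L \<and> continuous_on L f \<and> continuous_on L g"
      using \<K>(2)[OF L(2)] \<K>'(2)[OF L(3)] by (auto intro: continuous_on_subset)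
  qed
qed

lemma sigma_continuous_diff:
  assumes "sigma_continuous f" "sigma_continuous g"
  shows "sigma_continuous (\<lambda>u. f u - g u)"
proof -
  obtain \<K> where "countable \<K>" "\<Union>\<K> = UNIV"
    "\<And>K. K \<in> \<K> \<Longrightarrow> closed K \<and> continuous_on K f \<and> continuous_on K g"
    using sigma_continuous_common_cover[OF assms] by metis
  then show ?thesis
    unfolding sigma_continuous_def by (intro exI[of _ \<K>]) (simp add: continuous_on_diff)
qed

lemma sigma_continuous_divide:
  assumes "sigma_continuous f" "sigma_continuous g"
  shows "sigma_continuous (\<lambda>u. f u / g u)"
proof -
  obtain \<K> where \<K>: "countable \<K>" "\<Union>\<K> = UNIV"
    "\<And>K. K \<in> \<K> \<Longrightarrow> closed K \<and> continuous_on K f \<and> continuous_on K g"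
    using sigma_continuous_common_cover[OF assms] by metis
  \<comment> \<open>On \<open>Z K\<close> the quotient is constantly 0 because
    \<open>x / 0 = 0\<close>. The set where \<open>g\<close> does not vanish need not be closed, so
    it is exhausted by the closed sets \<open>P (K, n)\<close>, on which \<open>g\<close> is bounded
    away from 0.\<close>
  define Z where "Z K = {u \<in> K. g u = 0}" for K
  define P where "P = (\<lambda>(K, n). {u \<in> K. inverse (real (Suc n)) \<le> \<bar>g u\<bar>})"
  have "u \<in> \<Union> (Z ` \<K> \<union> P ` (\<K> \<times> UNIV))" for u
  proof -
    obtain K where K: "K \<in> \<K>" "u \<in> K" using \<K>(2) by blast
    show ?thesis
    proof (cases "g u = 0")
      case False
      then obtain n where "inverse (real (Suc n)) < \<bar>g u\<bar>"
        using reals_Archimedean[of "\<bar>g u\<bar>"] by auto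
      then have "u \<in> P (K, n)" using K by (simp add: P_def)
      then show ?thesis using K by (intro UnionI[of "P (K, n)"]) auto
    qed (use K in \<open>auto simp: Z_def\<close>)
  qed
  then have "\<Union> (Z ` \<K> \<union> P ` (\<K> \<times> UNIV)) = UNIV" by (metis UNIV_eq_I)
  moreover have "closed (Z K) \<and> continuous_on (Z K) (\<lambda>u. f u / g u)" if "K \<in> \<K>" for K
  proof
    show "closed (Z K)" unfolding Z_def
      using \<K>(3)[OF that] by (intro continuous_closed_preimage_constant) auto
    have "continuous_on (Z K) (\<lambda>u. 0 :: real)" by simp
    then show "continuous_on (Z K) (\<lambda>u. f u / g u)"
      by (rule continuous_on_eq) (simp add: Z_def)
  qed
  moreover have "closed (P (K, n)) \<and> continuous_on (P (K, n)) (\<lambda>u. f u / g u)" if "K \<in> \<K>" for K n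
  proof
    have "closed (K \<inter> (\<lambda>u. \<bar>g u\<bar>) -` {inverse (real (Suc n))..})"
      using \<K>(3)[OF that] by (intro continuous_closed_preimage continuous_intros) auto
    then show "closed (P (K, n))" by (simp add: P_def vimage_def Collect_conj_eq)
    have sub: "P (K, n) \<subseteq> K" by (auto simp: P_def)
    have "g u \<noteq> 0" if "u \<in> P (K, n)" for u
    proof
      assume "g u = 0"
      then have "inverse (real (Suc n)) \<le> 0" using that by (auto simp: P_def)
      then show False by simp
    qed
    then show "continuous_on (P (K, n)) (\<lambda>u. f u / g u)"
      using \<K>(3)[OF that] sub by (auto intro!: continuous_intros intro: continuous_on_subset)
  qed
  ultimately show ?thesis
    unfolding sigma_continuous_def using \<K>(1)
    by (intro exI[of _ "Z ` \<K> \<union> P ` (\<K> \<times> UNIV)"]) auto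
qed

lemma sigma_continuous_tm_val: "sigma_continuous (tm_val c t)"
proof (induction t)
  case Var
  show ?case by (rule sigma_continuous_if_continuous) simp
next
  case (Const n)
  show ?case by (rule sigma_continuous_if_continuous) simp
next
  case (Minus t t')
  then show ?case using sigma_continuous_diff by simp
next
  case (Div t t')
  then show ?case using sigma_continuous_divide by simp
next
  case (Sqrt t)
  then show ?case
    using sigma_continuous_compose[OF _ continuous_on_real_sqrt[OF continuous_on_id]] by simp
qed

section \<open>The category argument and the extension of the field\<close>

text \<open>On each closed piece the level set of \<open>s\<close> is closed. Countably many such
  sets cover the interval, so by Baire's theorem one of them contains an interval.\<close>

lemma sigma_continuous_family_level_interval:
  assumes "countable \<F>" "\<And>f. f \<in> \<F> \<Longrightarrow> sigma_continuous f"
    and "a < b" and cover: "\<And>u. a < u \<Longrightarrow> u < b \<Longrightarrow> \<exists>f\<in>\<F>. f u = s"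
  obtains f a' b' where "f \<in> \<F>" "a \<le> a'" "a' < b'" "b' \<le> b" "\<And>u. a' < u \<Longrightarrow> u < b' \<Longrightarrow> f u = s"
proof -
  have "\<exists>\<K>. countable \<K> \<and> (\<forall>K\<in>\<K>. closed K \<and> continuous_on K f) \<and> \<Union>\<K> = UNIV" if "f \<in> \<F>" for f
    using assms(2)[OF that] by (simp add: sigma_continuous_def)
  then obtain \<K> where \<K>: "\<And>f. f \<in> \<F> \<Longrightarrow> countable (\<K> f)" "\<And>f. f \<in> \<F> \<Longrightarrow> \<Union>(\<K> f) = UNIV"
    "\<And>f K. f \<in> \<F> \<Longrightarrow> K \<in> \<K> f \<Longrightarrow> closed K \<and> continuous_on K f"
    by metis
  define L where "L = (\<lambda>(f, K). {u \<in> K. (f :: real \<Rightarrow> real) u = s})"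
  have closed: "closed (L x)" if "x \<in> Sigma \<F> \<K>" for x
    using that \<K>(3) by (auto simp: L_def intro: continuous_closed_preimage_constant)
  \<comment> \<open>The cover is given on the open interval, while Baire's theorem is applied to a
    closed one: the middle third.\<close>
  define m where "m = (2 * a + b) / 3"
  define m' where "m' = (a + 2 * b) / 3"
  have m: "a < m" "m < m'" "m' < b" using \<open>a < b\<close> by (auto simp: m_def m'_def)
  have "\<exists>x\<in>Sigma \<F> \<K>. \<not> {m..m'} \<subseteq> closure ({m..m'} - L x)"
  proof (rule ccontr)
    assume dense: "\<not> ?thesis"
    \<comment> \<open>These sets are relatively open and, by \<open>dense\<close>, dense in
      \<open>{m..m'}\<close>; their intersection is empty because the level sets cover.\<close>
    let ?\<G> = "(\<lambda>x. {m..m'} - L x) ` Sigma \<F> \<K>"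
    have "\<exists>x\<in>Sigma \<F> \<K>. u \<in> L x" if u: "u \<in> {m..m'}" for u
    proof -
      obtain f where f: "f \<in> \<F>" "f u = s" using cover[of u] u m by auto
      moreover obtain K where "K \<in> \<K> f" "u \<in> K" using \<K>(2)[OF f(1)] by blast
      ultimately show ?thesis by (auto simp: L_def intro!: bexI[of _ "(f, K)"])
    qed
    moreover from this[of m] m have "Sigma \<F> \<K> \<noteq> {}" by auto
    ultimately have "\<Inter>?\<G> = {}" by blast
    moreover have "{m..m'} \<subseteq> closure (\<Inter>?\<G>)"
    proof (rule Baire)
      show "countable ?\<G>" using assms(1) \<K>(1) by auto
      show "openin (top_of_set {m..m'}) T \<and> {m..m'} \<subseteq> closure T" if "T \<in> ?\<G>" for T
        using that dense closed by (auto intro!: openin_open_Int simp: Diff_eq open_Compl)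
    qed simp
    ultimately show False using m by simp
  qed
  then obtain f K z where fK: "f \<in> \<F>" "K \<in> \<K> f"
    and z: "z \<in> {m..m'}" "z \<notin> closure ({m..m'} - L (f, K))"
    by (auto simp: subset_iff simp del: atLeastAtMost_iff)
  then obtain e where e: "e > 0" "\<And>y. y \<in> {m..m'} - L (f, K) \<Longrightarrow> \<not> dist y z < e"
    unfolding closure_approachable by blast
  \<comment> \<open>Points of \<open>{m..m'}\<close> closer than \<open>e\<close> to
    \<open>z\<close> lie in the level set. Clipping to \<open>{m..m'}\<close> leaves a nonempty open
    interval even if \<open>z\<close> is an endpoint.\<close>
  have "f u = s" if "max m (z - e) < u" "u < min m' (z + e)" for u
    using e(2)[of u] that z(1) by (auto simp: L_def dist_real_def abs_less_iff)
  then show ?thesis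
    using m z(1) e(1) fK(1) by (intro that[of f "max m (z - e)" "min m' (z + e)"]) auto
qed

text \<open>The new field consists of the values at \<open>u\<close> of all terms over
  \<open>F\<close>; it misses \<open>s\<close> exactly when no term takes the value \<open>s\<close>
  at \<open>u\<close>.\<close>

lemma euclidean_field_extension:
  assumes F: "euclidean_field F" "countable F" "s \<notin> F" and "a < b"
  obtains u F' where "a < u" "u < b" "u \<in> F'" "F \<subseteq> F'" "euclidean_field F'" "countable F'" "s \<notin> F'"
proof -
  have "F \<noteq> {}" using F(1) by (auto simp: euclidean_field_def)
  then have c: "range (from_nat_into F) = F" using F(2) by (rule range_from_nat_into)
  define \<F> where "\<F> = range (tm_val (from_nat_into F))"
  have "\<exists>u. a < u \<and> u < b \<and> (\<forall>f\<in>\<F>. f u \<noteq> s)"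
  proof (rule ccontr)
    assume "\<not> ?thesis"
    then have "\<And>u. a < u \<Longrightarrow> u < b \<Longrightarrow> \<exists>f\<in>\<F>. f u = s" by blast
    moreover have "countable \<F>" "\<And>f. f \<in> \<F> \<Longrightarrow> sigma_continuous f"
      by (auto simp: \<F>_def sigma_continuous_tm_val)
    ultimately obtain f a' b' where f: "f \<in> \<F>" "a' < b'" "\<And>u. a' < u \<Longrightarrow> u < b' \<Longrightarrow> f u = s"
      using sigma_continuous_family_level_interval[OF _ _ \<open>a < b\<close>, of \<F> s] by metis
    obtain q where "q \<in> \<rat>" "a' < q" "q < b'" using Rats_dense_in_real[OF f(2)] by blast
    then have "f q = s" "q \<in> F" using f(3) euclidean_field_Rats[OF F(1)] by auto
    moreover obtain t where "f = tm_val (from_nat_into F) t" using f(1) by (auto simp: \<F>_def)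
    ultimately have "s \<in> F" using tm_val_in_euclidean_field[OF F(1), of "from_nat_into F" q t] c by auto
    then show False using F(3) by blast
  qed
  then obtain u where u: "a < u" "u < b" "\<And>t. tm_val (from_nat_into F) t u \<noteq> s"
    by (auto simp: \<F>_def)
  let ?F = "range (\<lambda>t. tm_val (from_nat_into F) t u)"
  show ?thesis
  proof (rule that[of u ?F])
    have "u = tm_val (from_nat_into F) Var u" by simp
    then show "u \<in> ?F" by (rule range_eqI)
    show "F \<subseteq> ?F"
    proof
      fix x assume "x \<in> F"
      then obtain n where "x = from_nat_into F n" using c by auto
      then have "x = tm_val (from_nat_into F) (Const n) u" by simp
      then show "x \<in> ?F" by (rule range_eqI)
    qed
    show "euclidean_field ?F"
      using F(1) c by (intro euclidean_field_range_tm_val) (auto simp: euclidean_field_def)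
  qed (use u in \<open>auto simp: image_iff\<close>)
qed

text \<open>With 1 as the only constant, the terms have countably many values at 0, so their field
  misses some number of the unit interval.\<close>

lemma countable_euclidean_field_exists:
  obtains F s where "euclidean_field F" "countable F" "0 < s" "s \<notin> F"
proof -
  let ?F = "range (\<lambda>t. tm_val (\<lambda>_. 1) t 0)"
  have "countable ?F" by simp
  moreover have "uncountable {0 <..< 1 :: real}" by (simp add: uncountable_open_interval)
  ultimately obtain s where "s \<in> {0<..<1}" "s \<notin> ?F"
    by (meson countable_subset subsetI)
  then show ?thesis
    using that[of ?F s] euclidean_field_range_tm_val[of "\<lambda>_. 1" 0] by auto
qed

section \<open>Points and curves over a field\<close>

text \<open>With \<open>a = 1\<close> this form covers circles and with \<open>a = 0\<close> lines,
  so that one computation can handle every kind of intersection.\<close>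

definition equation_set :: "real \<Rightarrow> real \<Rightarrow> real \<Rightarrow> real \<Rightarrow> real \<Rightarrow> point set" where
  "equation_set s a b c d =
    {p. a * ((s * p $ 1)\<^sup>2 + (s * p $ 2)\<^sup>2) + b * (s * p $ 1) + c * (s * p $ 2) + d = 0}"

text \<open>The coordinates are taken in units of \<open>1 / s\<close>. The letters that remain unrestricted are the
  discs.\<close>

fun letter_over :: "real \<Rightarrow> real set \<Rightarrow> letter \<Rightarrow> bool" where
  "letter_over s F (Pt p) \<longleftrightarrow> s * p $ 1 \<in> F \<and> s * p $ 2 \<in> F"
| "letter_over s F (Fig X) \<longleftrightarrow> (X \<in> curves \<longrightarrow>
    (\<exists>a b c d. {a, b, c, d} \<subseteq> F \<and> X = equation_set s a b c d \<and> (a = 1 \<or> a = 0 \<and> (b \<noteq> 0 \<or> c \<noteq> 0))))"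

lemma letter_over_mono:
  assumes "letter_over s F l" "F \<subseteq> F'"
  shows "letter_over s F' l"
proof (cases l)
  case (Fig X)
  show ?thesis unfolding Fig letter_over.simps
  proof
    assume "X \<in> curves"
    then obtain a b c d where *: "{a, b, c, d} \<subseteq> F"
      "X = equation_set s a b c d \<and> (a = 1 \<or> a = 0 \<and> (b \<noteq> 0 \<or> c \<noteq> 0))"
      using assms(1) unfolding Fig letter_over.simps by blast
    from *(1) assms(2) have "{a, b, c, d} \<subseteq> F'" by (rule subset_trans)
    with *(2) show "\<exists>a b c d. {a, b, c, d} \<subseteq> F' \<and> X = equation_set s a b c d \<and>
        (a = 1 \<or> a = 0 \<and> (b \<noteq> 0 \<or> c \<noteq> 0))" by blast
  qed
qed (use assms in auto)

lemma dist_plane: "(dist p q)\<^sup>2 = (p $ 1 - q $ 1)\<^sup>2 + (p $ 2 - q $ 2)\<^sup>2" for p q :: point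
  by (simp add: dist_vec_def L2_set_def sum_2 dist_real_def)

lemma dist_1_imp_scale_mem:
  assumes "euclidean_field F" "s > 0" "letter_over s F (Pt p)" "letter_over s F (Pt q)" "dist p q = 1"
  shows "s \<in> F"
proof -
  have "(s * p $ 1 - s * q $ 1)\<^sup>2 + (s * p $ 2 - s * q $ 2)\<^sup>2 = s\<^sup>2 * (dist p q)\<^sup>2"
    unfolding dist_plane by (simp add: power2_eq_square algebra_simps)
  then have "s = sqrt ((s * p $ 1 - s * q $ 1)\<^sup>2 + (s * p $ 2 - s * q $ 2)\<^sup>2)"
    using assms by simp
  moreover have "\<dots> \<in> F" using assms by (auto intro!: euclidean_field_closed)
  ultimately show ?thesis by metis
qed

section \<open>Equations of lines and circles\<close>

text \<open>The equation says that \<open>s * s\<close> times the determinant of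
  \<open>x - p\<close> and \<open>q - p\<close> vanishes.\<close>

lemma affine_hull_eq_equation_set:
  fixes p q :: point
  assumes "s \<noteq> 0" "p \<noteq> q"
  shows "affine hull {p, q} = equation_set s 0 (s * q $ 2 - s * p $ 2) (s * p $ 1 - s * q $ 1)
    ((s * q $ 1 - s * p $ 1) * (s * p $ 2) - (s * q $ 2 - s * p $ 2) * (s * p $ 1))" (is "_ = ?R")
proof
  show "affine hull {p, q} \<subseteq> ?R"
  proof
    fix x assume "x \<in> affine hull {p, q}"
    then obtain u v where "x = u *\<^sub>R p + v *\<^sub>R q" "u + v = 1" unfolding affine_hull_2 by blast
    then have x: "x $ i = (1 - v) * p $ i + v * q $ i" for i by (simp add: eq_diff_eq)
    show "x \<in> ?R" by (simp add: equation_set_def x algebra_simps)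
  qed
  show "?R \<subseteq> affine hull {p, q}"
  proof
    fix x assume "x \<in> ?R"
    then have "s * s * ((q $ 2 - p $ 2) * (x $ 1 - p $ 1) - (q $ 1 - p $ 1) * (x $ 2 - p $ 2)) = 0"
      unfolding equation_set_def mem_Collect_eq by algebra
    then have *: "(q $ 2 - p $ 2) * (x $ 1 - p $ 1) = (q $ 1 - p $ 1) * (x $ 2 - p $ 2)"
      using \<open>s \<noteq> 0\<close> by simp
    \<comment> \<open>The two differences are parallel; the factor is read off in a coordinate where
      \<open>p\<close> and \<open>q\<close> differ.\<close>
    have "\<exists>v. x $ 1 - p $ 1 = v * (q $ 1 - p $ 1) \<and> x $ 2 - p $ 2 = v * (q $ 2 - p $ 2)"
    proof (cases "q $ 1 = p $ 1")
      case True
      then have "q $ 2 \<noteq> p $ 2" using \<open>p \<noteq> q\<close> by (auto simp: vec_eq_iff forall_2)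
      moreover have "x $ 1 = p $ 1" using True * calculation by simp
      ultimately show ?thesis using True
        by (intro exI[of _ "(x $ 2 - p $ 2) / (q $ 2 - p $ 2)"]) (simp add: field_simps)
    next
      case False
      then show ?thesis using *
        by (intro exI[of _ "(x $ 1 - p $ 1) / (q $ 1 - p $ 1)"]) (simp add: field_simps)
    qed
    then obtain v where "x = (1 - v) *\<^sub>R p + v *\<^sub>R q"
      by (auto simp: vec_eq_iff forall_2 algebra_simps)
    then show "x \<in> affine hull {p, q}"
      unfolding affine_hull_2 mem_Collect_eq
      by (intro exI[of _ "1 - v"] exI[of _ v]) simp
  qed
qed

lemma sphere_eq_equation_set:
  fixes p q r :: point
  assumes "s \<noteq> 0"
  shows "sphere p (dist q r) = equation_set s 1 (- 2 * (s * p $ 1)) (- 2 * (s * p $ 2))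
    ((s * p $ 1)\<^sup>2 + (s * p $ 2)\<^sup>2 - ((s * q $ 1 - s * r $ 1)\<^sup>2 + (s * q $ 2 - s * r $ 2)\<^sup>2))" (is "_ = ?R")
proof -
  have "x \<in> ?R \<longleftrightarrow> s\<^sup>2 * ((dist p x)\<^sup>2 - (dist q r)\<^sup>2) = 0" for x
    unfolding equation_set_def dist_plane by (simp add: algebra_simps power2_eq_square)
  moreover have "(dist p x)\<^sup>2 - (dist q r)\<^sup>2 = 0 \<longleftrightarrow> dist p x = dist q r" for x
    by simp
  ultimately have "x \<in> ?R \<longleftrightarrow> x \<in> sphere p (dist q r)" for x
    using assms by simp
  then show ?thesis by blast
qed

section \<open>Construction steps over a field\<close>

lemma letter_over_line_through:
  assumes "euclidean_field F" "s \<noteq> 0" "letter_over s F (Pt p)" "letter_over s F (Pt q)" "p \<noteq> q"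
  shows "letter_over s F (line_through p q)"
proof -
  have "s * q $ 2 - s * p $ 2 \<noteq> 0 \<or> s * p $ 1 - s * q $ 1 \<noteq> 0"
    using assms(2,5) by (auto simp: vec_eq_iff forall_2)
  then show ?thesis
    using assms unfolding line_through_def letter_over.simps affine_hull_eq_equation_set[OF assms(2,5)]
    \<comment> \<open>Reflexivity is used on the equation of sets first, since it fixes the four
      coefficients.\<close>
    by (intro impI exI conjI, rule_tac[2] refl) (auto intro!: euclidean_field_closed)
qed

lemma letter_over_circle_with:
  assumes "euclidean_field F" "s \<noteq> 0"
    and "letter_over s F (Pt p)" "letter_over s F (Pt q)" "letter_over s F (Pt r)"
  shows "letter_over s F (circle_with p q r)"
proof (cases "q = r")
  case False
  then show ?thesis
    using assms unfolding circle_with_def if_not_P[OF False] letter_over.simps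
      sphere_eq_equation_set[OF assms(2)]
    by (intro impI exI conjI, rule_tac[2] refl) (auto intro!: euclidean_field_closed)
qed (use assms in \<open>simp add: circle_with_def\<close>)

lemma letter_over_intersection:
  assumes F: "euclidean_field F"
    and X: "letter_over s F (Fig X)" "X \<in> curves" and Y: "letter_over s F (Fig Y)" "Y \<in> curves"
    and "X \<noteq> Y" "p \<in> X" "p \<in> Y"
  shows "letter_over s F (Pt p)"
proof -
  obtain a b c d where abcd: "{a, b, c, d} \<subseteq> F" "a = 1 \<or> a = 0 \<and> (b \<noteq> 0 \<or> c \<noteq> 0)"
    and X_eq: "X = equation_set s a b c d"
    using X unfolding letter_over.simps by blast
  obtain a' b' c' d' where abcd': "{a', b', c', d'} \<subseteq> F" "a' = 1 \<or> a' = 0 \<and> (b' \<noteq> 0 \<or> c' \<noteq> 0)"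
    and Y_eq: "Y = equation_set s a' b' c' d'"
    using Y unfolding letter_over.simps by blast
  let ?x = "s * p $ 1" and ?y = "s * p $ 2"
  have p: "a * (?x\<^sup>2 + ?y\<^sup>2) + b * ?x + c * ?y + d = 0"
    and p': "a' * (?x\<^sup>2 + ?y\<^sup>2) + b' * ?x + c' * ?y + d' = 0"
    using \<open>p \<in> X\<close> \<open>p \<in> Y\<close> unfolding X_eq Y_eq equation_set_def by auto
  have "?x \<in> F \<and> ?y \<in> F"
  proof (cases "a = 0 \<or> a' = 0")
    case False
    then have a: "a = 1" "a' = 1" using abcd(2) abcd'(2) by auto
    \<comment> \<open>Subtracting the two circle equations gives the radical axis. If its
      coefficients vanished, the circles would be concentric with a common point, hence
      equal.\<close>
    have radical: "(b - b') * ?x + (c - c') * ?y + (d - d') = 0"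
      using p p' unfolding a by (simp add: algebra_simps)
    moreover have "b - b' \<noteq> 0 \<or> c - c' \<noteq> 0"
    proof (rule ccontr)
      assume "\<not> ?thesis"
      then have "b = b'" "c = c'" "d = d'" using radical by auto
      then show False using \<open>X \<noteq> Y\<close> by (simp add: X_eq Y_eq a)
    qed
    ultimately show ?thesis
      using abcd(1) abcd'(1) a(2) p'
      by (intro euclidean_field_line_meets[OF F, of "b - b'" "c - c'" "d - d'" a' b' c' d'])
        (auto intro: euclidean_field_diff[OF F])
  next
    case True
    \<comment> \<open>Two lines with vanishing determinant and the common point \<open>p\<close>
      coincide, because \<open>p\<close> determines both constant terms.\<close>
    have ne: "c' * b \<noteq> b' * c" if a: "a = 0" "a' = 0"
    proof
      assume parallel: "c' * b = b' * c"
      have "b * z + c * w + d = 0 \<longleftrightarrow> b' * z + c' * w + d' = 0" for z w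
      proof -
        have d: "d = - b * ?x - c * ?y" "d' = - b' * ?x - c' * ?y" using p p' a by auto
        have "b * (b' * z + c' * w + d') = b' * (b * z + c * w + d)"
          "c * (b' * z + c' * w + d') = c' * (b * z + c * w + d)"
          unfolding d using parallel by algebra+
        then show ?thesis using abcd(2) abcd'(2) a by auto
      qed
      then have "X = Y" unfolding X_eq Y_eq equation_set_def a by simp
      then show False using \<open>X \<noteq> Y\<close> by blast
    qed
    show ?thesis
    proof (cases "a = 0")
      case True
      then show ?thesis
        using abcd abcd' ne p p'
        by (intro euclidean_field_line_meets[OF F, of b c d a' b' c' d']) auto
    next
      case False
      \<comment> \<open>Here \<open>Y\<close> is the line and \<open>X\<close> a circle, so the
        roles are exchanged.\<close>
      then show ?thesis
        using \<open>a = 0 \<or> a' = 0\<close> abcd abcd' p p'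
        by (intro euclidean_field_line_meets[OF F, of b' c' d' a b c d]) auto
    qed
  qed
  then show ?thesis by simp
qed

text \<open>The coordinates are chosen one after the other, the second over the field already
  extended by the first.\<close>

lemma letter_over_arbitrary_point:
  assumes F: "euclidean_field F" "countable F" "s \<notin> F" and "s > 0" "D \<in> discs"
  obtains p F' where "p \<in> D" "letter_over s F' (Pt p)" "F \<subseteq> F'"
    "euclidean_field F'" "countable F'" "s \<notin> F'"
proof -
  obtain z \<rho> where D: "D = ball z \<rho>" "\<rho> > 0" using assms(5) by (auto simp: discs_def)
  \<comment> \<open>Half the radius in scaled units: two coordinate errors below
    \<open>\<rho> / 2\<close> add up to a distance below \<open>\<rho>\<close>.\<close>
  define \<epsilon> where "\<epsilon> = s * (\<rho> / 2)"
  have \<epsilon>: "\<epsilon> > 0" using D \<open>s > 0\<close> by (simp add: \<epsilon>_def)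
  obtain u F1 where u: "s * z $ 1 - \<epsilon> < u" "u < s * z $ 1 + \<epsilon>" "u \<in> F1"
    and F1: "F \<subseteq> F1" "euclidean_field F1" "countable F1" "s \<notin> F1"
    using euclidean_field_extension[OF F, of "s * z $ 1 - \<epsilon>" "s * z $ 1 + \<epsilon>"] \<epsilon> by auto
  obtain v F2 where v: "s * z $ 2 - \<epsilon> < v" "v < s * z $ 2 + \<epsilon>" "v \<in> F2"
    and F2: "F1 \<subseteq> F2" "euclidean_field F2" "countable F2" "s \<notin> F2"
    using euclidean_field_extension[OF F1(2-4), of "s * z $ 2 - \<epsilon>" "s * z $ 2 + \<epsilon>"] \<epsilon> by auto
  define p :: point where "p = vector [u / s, v / s]"
  have "\<bar>z $ 1 - p $ 1\<bar> < \<rho> / 2" "\<bar>z $ 2 - p $ 2\<bar> < \<rho> / 2"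
    using u(1,2) v(1,2) \<open>s > 0\<close> by (auto simp: p_def \<epsilon>_def abs_if field_simps)
  moreover have "dist z p \<le> \<bar>z $ 1 - p $ 1\<bar> + \<bar>z $ 2 - p $ 2\<bar>"
    using norm_le_l1_cart[of "z - p"] by (simp add: dist_norm sum_2)
  ultimately have "p \<in> D" by (simp add: D)
  moreover have "letter_over s F2 (Pt p)"
    using u v F2(1) \<open>s > 0\<close> by (auto simp: p_def)
  ultimately show ?thesis using that F1 F2 by blast
qed

section \<open>The branch\<close>

text \<open>The field is chosen for each word separately, so it may grow along a branch while
  \<open>s\<close> stays fixed.\<close>

definition word_avoids :: "real \<Rightarrow> letter list \<Rightarrow> bool" where
  "word_avoids s u \<longleftrightarrow>
    (\<exists>F. euclidean_field F \<and> countable F \<and> s \<notin> F \<and> (\<forall>l\<in>set u. letter_over s F l))"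

lemma word_avoids_snoc:
  assumes "euclidean_field F" "countable F" "s \<notin> F" "\<forall>l\<in>set u. letter_over s F l" "letter_over s F l"
  shows "word_avoids s (u @ [l])"
  using assms by (auto simp: word_avoids_def)

lemma word_avoids_dist:
  assumes "word_avoids s u" "s > 0" "Pt p \<in> set u" "Pt q \<in> set u"
  shows "dist p q \<noteq> 1"
proof
  assume "dist p q = 1"
  obtain F where "euclidean_field F" "s \<notin> F" "letter_over s F (Pt p)" "letter_over s F (Pt q)"
    using assms(1,3,4) unfolding word_avoids_def by blast
  then show False using dist_1_imp_scale_mem \<open>s > 0\<close> \<open>dist p q = 1\<close> by blast
qed

text \<open>Only an arbitrary point enlarges the field; every other new letter is over the field at
  hand.\<close>

lemma EC_rule_word_avoids:
  assumes "EC_rule discs u W" "W \<noteq> {}" "word_avoids s u" "s > 0"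
  shows "\<exists>v\<in>W. word_avoids s v"
proof -
  obtain F where F: "euclidean_field F" "countable F" "s \<notin> F" and u: "\<forall>l\<in>set u. letter_over s F l"
    using assms(3) by (auto simp: word_avoids_def)
  have nth: "letter_over s F l" if "u ! i = l" "i < length u" for i l
    using that u nth_mem by blast
  note snoc = word_avoids_snoc[OF F u]
  show ?thesis
    using assms(1)
  proof cases
    case leaf
    then show ?thesis using assms(2) by simp
  next
    case (line i j a b)
    then show ?thesis
      using nth[of i] nth[of j] \<open>s > 0\<close> by (auto intro!: snoc letter_over_line_through F)
  next
    case (circle i j k a b c)
    then show ?thesis
      using nth[of i] nth[of j] nth[of k] \<open>s > 0\<close> by (auto intro!: snoc letter_over_circle_with F)
  next
    case (intersection i j X Y p)
    then have "letter_over s F (Pt p)"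
      using nth[of i] nth[of j] by (intro letter_over_intersection[OF F(1), where X = X and Y = Y]) auto
    then show ?thesis using intersection snoc by blast
  next
    case (introduce X)
    \<comment> \<open>A disc is not a curve, so the condition on this letter is vacuous.\<close>
    then have "letter_over s F (Fig X)" using admissible_discs by (auto simp: admissible_def)
    then show ?thesis using introduce snoc by blast
  next
    case (arbitrary_point X)
    obtain p F' where p: "p \<in> X" "letter_over s F' (Pt p)" "F \<subseteq> F'"
      and F': "euclidean_field F'" "countable F'" "s \<notin> F'"
      using letter_over_arbitrary_point[OF F \<open>s > 0\<close>] arbitrary_point by metis
    have "\<forall>l\<in>set u. letter_over s F' l" using u letter_over_mono p(3) by blast
    then show ?thesis using word_avoids_snoc[OF F' _ p(2)] p(1) arbitrary_point by blast
  qed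
qed

section \<open>Branches along which a property persists\<close>

text \<open>Repeatedly choosing a child with the property gives a walk from the root, which either
  never meets a leaf or is cut at the first one.\<close>

lemma rooted_tree_branch_preserving:
  assumes "rooted_tree r V E" "P r"
    and step: "\<And>u. u \<in> V \<Longrightarrow> children E u \<noteq> {} \<Longrightarrow> P u \<Longrightarrow> \<exists>v\<in>children E u. P v"
  obtains B where "branch V E B" "\<forall>u\<in>walk_verts B. P u"
proof -
  have E: "E \<subseteq> V \<times> V" and "r \<in> V" using assms(1) by (auto simp: rooted_tree_def)
  \<comment> \<open>At a leaf \<open>SOME\<close> yields an unspecified value, so \<open>f\<close>
    is meaningful only up to the first leaf.\<close>
  define f where "f = rec_nat r (\<lambda>_ u. SOME v. v \<in> children E u \<and> P v)"
  have f0: "f 0 = r" and fSuc: "f (Suc n) = (SOME v. v \<in> children E (f n) \<and> P v)" for n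
    by (auto simp: f_def)
  have next_vertex: "(f n, f (Suc n)) \<in> E \<and> P (f (Suc n))"
    if "f n \<in> V" "P (f n)" "\<not> is_leaf V E (f n)" for n
  proof -
    have "\<exists>v. v \<in> children E (f n) \<and> P v"
      using step[of "f n"] that by (auto simp: is_leaf_def)
    from someI_ex[OF this] show ?thesis by (simp add: fSuc children_def)
  qed
  have inv: "f n \<in> V \<and> P (f n)" if "\<And>m. m < n \<Longrightarrow> \<not> is_leaf V E (f m)" for n
    using that
  proof (induction n)
    case 0
    then show ?case using \<open>r \<in> V\<close> assms(2) by (simp add: f0)
  next
    case (Suc n)
    then show ?case using next_vertex[of n] E by auto
  qed
  show ?thesis
  proof (cases "\<exists>n. is_leaf V E (f n)")
    case False
    then have "is_walk V E (InfWalk f)" using inv next_vertex by auto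
    then show ?thesis
      using that[of "InfWalk f"] branch_iff(2)[OF assms(1), of f] f0 inv False
      by (auto simp del: branch.simps)
  next
    case True
    define n where "n = (LEAST n. is_leaf V E (f n))"
    have n: "is_leaf V E (f n)" "\<And>m. m < n \<Longrightarrow> \<not> is_leaf V E (f m)"
      using True unfolding n_def by (auto intro: LeastI_ex dest: not_less_Least)
    have inv': "f m \<in> V \<and> P (f m)" if "m \<le> n" for m
      using that n(2) inv[of m] by auto
    have "is_walk V E (FinWalk (map f [0..<Suc n]))"
      using inv' next_vertex n(2) by (auto simp: nth_append less_Suc_eq simp del: upt_Suc)
    moreover have "hd (map f [0..<Suc n]) = r" by (simp add: hd_map f0 del: upt_Suc)
    moreover have "last (map f [0..<Suc n]) = f n" by simp
    ultimately have "branch V E (FinWalk (map f [0..<Suc n]))"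
      using branch_iff(1)[OF assms(1)] n(1) by metis
    then show ?thesis
      using that[of "FinWalk (map f [0..<Suc n])"] inv' by auto
  qed
qed

lemma EC_branch_without_unit_distance:
  assumes "EC discs [] V E"
  obtains B where "branch V E B"
    "\<And>u p q. u \<in> walk_verts B \<Longrightarrow> Pt p \<in> set u \<Longrightarrow> Pt q \<in> set u \<Longrightarrow> dist p q \<noteq> 1"
proof -
  obtain F s where "euclidean_field F" "countable F" and s: "0 < s" "s \<notin> F"
    by (rule countable_euclidean_field_exists)
  then have "word_avoids s []" by (auto simp: word_avoids_def)
  moreover have "rooted_tree [] V E" and rule: "\<And>u. u \<in> V \<Longrightarrow> EC_rule discs u (children E u)"
    using assms by (auto simp: EC_def)
  ultimately obtain B where "branch V E B" "\<forall>u\<in>walk_verts B. word_avoids s u"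
    using EC_rule_word_avoids[OF rule _ _ s(1)] rooted_tree_branch_preserving[of "[]" V E "word_avoids s"]
    by metis
  then show ?thesis using that word_avoids_dist[OF _ s(1)] by blast
qed

theorem theorem2p7:
  "(\<forall>V E. EC discs [] V E \<longrightarrow>
      (\<exists>B. branch V E B \<and>
        (\<forall>u\<in>walk_verts B. \<forall>p q. Pt p \<in> set u \<and> Pt q \<in> set u \<and> p \<noteq> q \<longrightarrow> dist p q \<noteq> 1)))
   \<and> \<not> constructs_from discs unit_pairs []"
proof
  show "\<forall>V E. EC discs [] V E \<longrightarrow>
      (\<exists>B. branch V E B \<and>
        (\<forall>u\<in>walk_verts B. \<forall>p q. Pt p \<in> set u \<and> Pt q \<in> set u \<and> p \<noteq> q \<longrightarrow> dist p q \<noteq> 1))"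
    using EC_branch_without_unit_distance by metis
  show "\<not> constructs_from discs unit_pairs []"
  proof
    assume "constructs_from discs unit_pairs []"
    then obtain V E where EC: "EC discs [] V E" "terminating V E"
      and leaf: "\<And>u. is_leaf V E u \<Longrightarrow> \<exists>j<length u. drop j u \<in> unit_pairs"
      unfolding constructs_from_def by blast
    obtain B where B: "branch V E B"
      "\<And>u p q. u \<in> walk_verts B \<Longrightarrow> Pt p \<in> set u \<Longrightarrow> Pt q \<in> set u \<Longrightarrow> dist p q \<noteq> 1"
      using EC_branch_without_unit_distance[OF EC(1)] by metis
    \<comment> \<open>Termination makes this branch finite, so it ends in a leaf, whose last two
      letters would be points at distance 1.\<close>
    then obtain vs where vs: "B = FinWalk vs" using EC(2) by (auto simp: terminating_def)
    have "rooted_tree [] V E" using EC(1) by (simp add: EC_def)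
    then have "vs \<noteq> []" "is_leaf V E (last vs)" using B(1) branch_iff(1)[of "[]" V E vs]
      unfolding vs by (auto simp del: branch.simps)
    then obtain j a b where ab: "drop j (last vs) = [Pt a, Pt b]" "dist a b = 1"
      using leaf by (fastforce simp: unit_pairs_def)
    then have "Pt a \<in> set (last vs)" "Pt b \<in> set (last vs)"
      by (metis in_set_dropD list.set_intros)+
    then show False using B(2)[of "last vs"] ab(2) \<open>vs \<noteq> []\<close> by (simp add: vs)
  qed
qed

end
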